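(* Let $\mathcal{X}$ be a finite field, let $p_X,p_K\in\mathcal{P}(\mathcal{X})$, and let $\delta_0>0$. For every $\delta\in(0,\delta_0]$, $$R^{\star}(p_X,p_K)\le R_{\mathrm{v,inf}}(\delta|p_X,p_K)\le R_{\mathrm{v,inf}}(p_X,p_K),$$ where $R^{\star}(p_X,p_K)=H(X)$ if $H(X)\le H(K)$, and $R^{\star}(p_X,p_K)=+\infty$ otherwise.
   Context: All logarithms are to base 2 and $\mathbb{N}=\{1,2,\ldots\}$. $\mathcal{P}(\mathcal{X})$ is the set of probability distributions on $\mathcal{X}$; $H(X)$ and $H(K)$ are the Shannon entropies of $p_X$ and $p_K$; $I(\cdot;\cdot)$ is mutual information. Source and key: $\boldsymbol{X}=X_1\cdots X_n$ is i.i.d. with law $p_X$, $\boldsymbol{K}=K_1\cdots K_n$ is i.i.d. with law $p_K$, and $\boldsymbol{X}$ and $\boldsymbol{K}$ are independent. Scheme: let $\mathcal{Y}=\{0,1\}$ and $\mathcal{Y}^*=\bigcup_{l\in\mathbb{N}}\mathcal{Y}^l$, and let $|y|$ be the length of $y\in\mathcal{Y}^*$. A variable-length source encryption scheme of block length $n$ is a pair of maps $\Phi^{(n)}:\mathcal{X}^n\times\mathcal{X}^n\to\mathcal{Y}^*$, $\Psi^{(n)}:\mathcal{X}^n\times\mathcal{Y}^*\to\mathcal{X}^n$, written $\Phi_{\boldsymbol{k}}^{(n)}(\boldsymbol{x})=\Phi^{(n)}(\boldsymbol{k},\boldsymbol{x})$ and $\Psi_{\boldsymbol{k}}^{(n)}(c)=\Psi^{(n)}(\boldsymbol{k},c)$,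 with $\Psi_{\boldsymbol{k}}^{(n)}(\Phi_{\boldsymbol{k}}^{(n)}(\boldsymbol{x}))=\boldsymbol{x}$ for all $\boldsymbol{k},\boldsymbol{x}\in\mathcal{X}^n$. The ciphertext is $C^{(n)}=\Phi_{\boldsymbol{K}}^{(n)}(\boldsymbol{X})$, and the average codeword length is $\overline{L}_{\Phi^{(n)}}=\mathrm{E}\left[|\Phi_{\boldsymbol{K}}^{(n)}(\boldsymbol{X})|\right]$. Admissible rates: for $\delta\in(0,\delta_0]$, a real number $R$ is $\delta$-admissible (for $(p_X,p_K)$) if there exists a sequence of schemes $\{(\Phi^{(n)},\Psi^{(n)})\}_{n=1}^\infty$ such that for every $\gamma>0$ there is $n_0=n_0(\gamma)\in\mathbb{N}$ such that for all $n\ge n_0$: $\frac1n\overline{L}_{\Phi^{(n)}}\le R+\gamma$ and $I(C^{(n)};\boldsymbol{X})\le\delta$. $R_{\mathrm{v,inf}}(\delta|p_X,p_K)$ is the infimum of all $\delta$-admissible $R$ (with $\inf\emptyset=+\infty$), and $R_{\mathrm{v,inf}}(p_X,p_K)=\sup_{\delta\in(0,\delta_0]}R_{\mathrm{v,inf}}(\delta|p_X,p_K)$. *)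

theory Defs
  imports "HOL-Probability.Probability"
begin

definition shannon_entropy :: "'a::finite pmf \<Rightarrow> real" where
  "shannon_entropy p = prob_space.entropy (measure_pmf p) 2 (count_space UNIV) (\<lambda>x. x)"

lemma distributed_map_pmf:
  "distributed (measure_pmf p) (count_space UNIV) f (\<lambda>x. ennreal (pmf (map_pmf f p) x))"
  by (simp add: distributed_def map_pmf_rep_eq[symmetric] measure_pmf_eq_density[symmetric])

lemma shannon_entropy_eq_sum:
  "shannon_entropy p = - (\<Sum>x\<in>UNIV. pmf p x * log 2 (pmf p x))"
proof -
  interpret information_space "measure_pmf p" 2
    by unfold_locales simp
  have "distributed (measure_pmf p) (count_space UNIV) (\<lambda>x. x) (\<lambda>x. ennreal (pmf p x))"
    using distributed_map_pmf[of p "\<lambda>x. x"] by (simp add: pmf.map_ident)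
  from entropy_distr[OF this] show ?thesis
    by (simp add: shannon_entropy_def lebesgue_integral_count_space_finite)
qed

definition blocks :: "nat \<Rightarrow> 'a list set" where
  "blocks n = {xs. length xs = n}"

text \<open>The set \<open>\<Y>\<^sup>*\<close> of codewords is the union of \<open>{0,1}\<^sup>l\<close> over \<open>l \<ge> 1\<close>: the empty word is
  not a codeword, and no prefix condition is imposed.\<close>

definition codewords :: "bool list set" where
  "codewords = (\<Union>l\<in>{1..}. blocks l)"

text \<open>Maps are total functions on lists; only their behaviour on \<open>blocks n\<close> and \<open>codewords\<close>
  is relevant. The key is the first argument.\<close>

definition is_scheme ::
  "nat \<Rightarrow> ('a list \<Rightarrow> 'a list \<Rightarrow> bool list) \<Rightarrow> ('a list \<Rightarrow> bool list \<Rightarrow> 'a list) \<Rightarrow> bool" where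
  "is_scheme n \<Phi> \<Psi> \<longleftrightarrow>
     (\<forall>k\<in>blocks n. \<forall>x\<in>blocks n. \<Phi> k x \<in> codewords) \<and>
     (\<forall>k\<in>blocks n. \<forall>c\<in>codewords. \<Psi> k c \<in> blocks n) \<and>
     (\<forall>k\<in>blocks n. \<forall>x\<in>blocks n. \<Psi> k (\<Phi> k x) = x)"

text \<open>Joint law of \<open>(K, X)\<close>: independent blocks, each with i.i.d. entries.\<close>

definition key_source_pmf :: "nat \<Rightarrow> 'a::finite pmf \<Rightarrow> 'a pmf \<Rightarrow> ('a list \<times> 'a list) pmf" where
  "key_source_pmf n pX pK = pair_pmf (replicate_pmf n pK) (replicate_pmf n pX)"

definition avg_length ::
  "nat \<Rightarrow> 'a::finite pmf \<Rightarrow> 'a pmf \<Rightarrow> ('a list \<Rightarrow> 'a list \<Rightarrow> bool list) \<Rightarrow> real" where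
  "avg_length n pX pK \<Phi> =
     measure_pmf.expectation (key_source_pmf n pX pK) (\<lambda>(k, x). real (length (\<Phi> k x)))"

definition leakage ::
  "nat \<Rightarrow> 'a::finite pmf \<Rightarrow> 'a pmf \<Rightarrow> ('a list \<Rightarrow> 'a list \<Rightarrow> bool list) \<Rightarrow> real" where
  "leakage n pX pK \<Phi> =
     prob_space.mutual_information (measure_pmf (key_source_pmf n pX pK)) 2
       (count_space UNIV) (count_space UNIV) (\<lambda>(k, x). \<Phi> k x) (\<lambda>(k, x). x)"

lemma mutual_information_pmf_eq_sum:
  fixes f :: "'a \<Rightarrow> 'b::countable" and g :: "'a \<Rightarrow> 'c::countable"
  assumes "finite (set_pmf p)"
  shows "prob_space.mutual_information (measure_pmf p) 2 (count_space UNIV) (count_space UNIV) f g =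
    (\<Sum>(a, b)\<in>(\<lambda>w. (f w, g w)) ` set_pmf p. pmf (map_pmf (\<lambda>w. (f w, g w)) p) (a, b) *
       log 2 (pmf (map_pmf (\<lambda>w. (f w, g w)) p) (a, b) / (pmf (map_pmf f p) a * pmf (map_pmf g p) b)))"
proof -
  interpret information_space "measure_pmf p" 2
    by unfold_locales simp
  have cs: "count_space UNIV \<Otimes>\<^sub>M count_space UNIV = (count_space UNIV :: ('b \<times> 'c) measure)"
    by (simp add: pair_measure_countable)
  have fin: "finite ((\<lambda>w. (f w, g w)) ` set_pmf p)"
    using assms by simp
  show ?thesis
    unfolding mutual_information_distr[OF sigma_finite_measure_count_space
        sigma_finite_measure_count_space distributed_map_pmf pmf_nonneg distributed_map_pmf
        pmf_nonneg distributed_map_pmf[of p "\<lambda>w. (f w, g w)", folded cs] pmf_nonneg]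
    unfolding cs case_prod_beta
    by (subst lebesgue_integral_count_space_finite_support[OF finite_subset[OF _ fin]])
      (auto simp: set_pmf_eq[symmetric] pmf_eq_0_set_pmf intro!: sum.mono_neutral_left fin)
qed

definition admissible :: "real \<Rightarrow> 'a::finite pmf \<Rightarrow> 'a pmf \<Rightarrow> real \<Rightarrow> bool" where
  "admissible \<delta> pX pK R \<longleftrightarrow>
     (\<exists>\<Phi> \<Psi>. (\<forall>n\<ge>1. is_scheme n (\<Phi> n) (\<Psi> n)) \<and>
       (\<forall>\<gamma>>0. \<exists>n0\<ge>1. \<forall>n\<ge>n0.
          avg_length n pX pK (\<Phi> n) / real n \<le> R + \<gamma> \<and> leakage n pX pK (\<Phi> n) \<le> \<delta>))"

definition R_vinf_delta :: "real \<Rightarrow> 'a::finite pmf \<Rightarrow> 'a pmf \<Rightarrow> ereal" where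
  "R_vinf_delta \<delta> pX pK = (INF R\<in>{R. admissible \<delta> pX pK R}. ereal R)"

definition R_vinf :: "real \<Rightarrow> 'a::finite pmf \<Rightarrow> 'a pmf \<Rightarrow> ereal" where
  "R_vinf \<delta>\<^sub>0 pX pK = (SUP \<delta>\<in>{0<..\<delta>\<^sub>0}. R_vinf_delta \<delta> pX pK)"

definition R_star :: "'a::finite pmf \<Rightarrow> 'a pmf \<Rightarrow> ereal" where
  "R_star pX pK =
     (if shannon_entropy pX \<le> shannon_entropy pK then ereal (shannon_entropy pX) else \<infinity>)"

end

theory Submission
  imports Defs
begin

text \<open>
  Everything rests on Gibbs' inequality against a subprobability weight evaluated at the
  ciphertext: for a fixed key \<open>k\<close> the map \<open>\<Phi> k\<close> is injective, so such a weight stays a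
  subprobability when pulled back to source blocks.

  Choosing the law of the ciphertext \<open>C\<close> gives \<open>H(C) \<ge> n H(X)\<close>. Since \<open>p(c, x) \<ge> p(k) p(x)\<close>,
  also \<open>I(C; X) \<ge> H(C) - n H(K)\<close>. Hence \<open>n (H(X) - H(K)) \<le> \<delta>\<close> for all large \<open>n\<close>,
  which forces \<open>H(X) \<le> H(K)\<close>.

  Codewords need not be prefix-free, so \<open>2 powr (- |c|)\<close> is not summable; but
  \<open>2 powr (- (1 + \<epsilon>) |c|)\<close> is, with a total independent of \<open>n\<close>. This gives
  \<open>n H(X) \<le> (1 + \<epsilon>) L + O(1)\<close> for the average length \<open>L\<close>, and \<open>n \<rightarrow> \<infinity>\<close>, \<open>\<epsilon> \<rightarrow> 0\<close> yield \<open>H(X) \<le> R\<close>.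
\<close>

section \<open>Finite-support expectations and entropy of i.i.d. blocks\<close>

lemma finite_set_replicate_pmf:
  fixes p :: "'a::finite pmf"
  shows "finite (set_pmf (replicate_pmf n p))"
  by (rule finite_subset[OF _ finite_lists_length_eq[of UNIV n]]) (auto simp: set_replicate_pmf)

lemma set_replicate_pmf_subset_blocks: "set_pmf (replicate_pmf n p) \<subseteq> blocks n"
  by (auto simp: set_replicate_pmf blocks_def)

lemma expectation_mono_finite:
  fixes f g :: "'a \<Rightarrow> real"
  assumes "finite (set_pmf p)" "\<And>x. x \<in> set_pmf p \<Longrightarrow> f x \<le> g x"
  shows "measure_pmf.expectation p f \<le> measure_pmf.expectation p g"
  using assms by (intro integral_mono_AE integrable_measure_pmf_finite) (auto simp: AE_measure_pmf_iff)

lemma expectation_finite: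
  fixes f :: "'a \<Rightarrow> real"
  assumes "finite (set_pmf p)"
  shows "measure_pmf.expectation p f = (\<Sum>x\<in>set_pmf p. pmf p x * f x)"
  using assms by (subst integral_measure_pmf_real[of "set_pmf p"]) (auto simp: mult.commute)

lemma sum_pmf_le_1:
  assumes "finite A"
  shows "(\<Sum>x\<in>A. pmf p x) \<le> 1"
  using assms by (simp add: measure_measure_pmf_finite[symmetric] measure_pmf.prob_le_1)

lemma expectation_pair_pmf_finite:
  fixes f :: "'a \<times> 'b \<Rightarrow> real"
  assumes "finite (set_pmf p)" "finite (set_pmf q)"
  shows "measure_pmf.expectation (pair_pmf p q) f =
    measure_pmf.expectation p (\<lambda>x. measure_pmf.expectation q (\<lambda>y. f (x, y)))"
  using assms
  by (auto simp: expectation_finite sum.cartesian_product sum_distrib_left pmf_pair mult.assoc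
      intro!: sum.cong)

lemma expectation_log_pmf_eq_entropy:
  "measure_pmf.expectation p (\<lambda>x. log 2 (pmf p x)) = - shannon_entropy p"
  by (subst integral_measure_pmf_real[of UNIV]) (auto simp: shannon_entropy_eq_sum mult.commute)

text \<open>Entropy is additive over independent letters: the log-probability of a block splits off
  its first letter. It is phrased as an expected log-probability because Gibbs' inequality produces
  that form.\<close>

lemma expectation_log_pmf_replicate:
  fixes p :: "'a::finite pmf"
  shows "measure_pmf.expectation (replicate_pmf n p) (\<lambda>xs. log 2 (pmf (replicate_pmf n p) xs))
    = - real n * shannon_entropy p"
proof (induction n)
  case 0
  show ?case by simp
next
  case (Suc n)
  let ?q = "replicate_pmf n p"
  have eq: "replicate_pmf (Suc n) p = map_pmf (\<lambda>(x, xs). x # xs) (pair_pmf p ?q)"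
    by (simp add: pair_pmf_def map_bind_pmf)
  \<comment> \<open>Cons is injective, so pushing the pair law forward merges no mass.\<close>
  have pmf: "pmf (replicate_pmf (Suc n) p) (x # xs) = pmf p x * pmf ?q xs" for x xs
    unfolding eq using pmf_map_inj'[of "\<lambda>(x, xs). x # xs" "pair_pmf p ?q" "(x, xs)"]
    by (auto simp: inj_on_def pmf_pair)
  have fin: "finite (set_pmf (pair_pmf p ?q))"
    by (simp add: finite_set_replicate_pmf)
  have "measure_pmf.expectation (replicate_pmf (Suc n) p)
      (\<lambda>xs. log 2 (pmf (replicate_pmf (Suc n) p) xs))
    = measure_pmf.expectation (pair_pmf p ?q)
      (\<lambda>w. log 2 (pmf (replicate_pmf (Suc n) p) (case w of (x, xs) \<Rightarrow> x # xs)))"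
    by (subst (1) eq) (rule integral_map_pmf)
  also have "\<dots> = measure_pmf.expectation (pair_pmf p ?q)
      (\<lambda>w. log 2 (pmf p (fst w)) + log 2 (pmf ?q (snd w)))"
    unfolding expectation_finite[OF fin]
    by (intro sum.cong) (auto simp: pmf pmf_pair log_mult set_pmf_iff simp del: replicate_pmf.simps)
  also have "\<dots> = - shannon_entropy p - real n * shannon_entropy p"
    using Suc.IH
    by (simp add: Bochner_Integration.integral_add integrable_measure_pmf_finite[OF fin]
        expectation_pair_pmf_fst[where f = "\<lambda>x. log 2 (pmf p x)"]
        expectation_pair_pmf_snd[where f = "\<lambda>x. log 2 (pmf ?q x)"]
        expectation_log_pmf_eq_entropy del: set_pair_pmf)
  finally show ?case
    by (simp add: algebra_simps)
qed

section \<open>Gibbs' inequality\<close>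

text \<open>Sum ln t \<le> t - 1 at t = q x / (p x * M), weighted by p x. The bound \<open>M\<close>
  on the total weight is left free: ciphertext probabilities use \<open>M = 1\<close>, the length
  weights need a larger constant.\<close>

lemma gibbs_inequality:
  fixes p :: "'a pmf"
  assumes fin: "finite (set_pmf p)" and pos: "\<And>x. x \<in> set_pmf p \<Longrightarrow> q x > 0"
    and le: "(\<Sum>x\<in>set_pmf p. q x) \<le> M"
  shows "measure_pmf.expectation p (\<lambda>x. log 2 (q x))
    \<le> measure_pmf.expectation p (\<lambda>x. log 2 (pmf p x)) + log 2 M"
proof -
  let ?S = "set_pmf p"
  have "(\<Sum>x\<in>?S. q x) > 0"
    using fin pos by (intro sum_pos) (auto simp: set_pmf_not_empty)
  then have M: "M > 0" using le by simp
  have sum1: "(\<Sum>x\<in>?S. pmf p x) = 1"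
    using fin by (simp add: sum_pmf_eq_1)
  have summand: "pmf p x * (log 2 (q x) - log 2 (pmf p x) - log 2 M) \<le> (q x / M - pmf p x) / ln 2"
    if x: "x \<in> ?S" for x
  proof -
    have p: "pmf p x > 0" using x by (simp add: pmf_positive)
    have "ln (q x) - ln (pmf p x) - ln M = ln (q x / (pmf p x * M))"
      using p M pos[OF x] by (simp add: ln_div ln_mult)
    also have "\<dots> \<le> q x / (pmf p x * M) - 1"
      using p M pos[OF x] by (intro ln_le_minus_one) auto
    finally have "pmf p x * (ln (q x) - ln (pmf p x) - ln M)
        \<le> pmf p x * (q x / (pmf p x * M) - 1)"
      using p by (intro mult_left_mono) auto
    also have "\<dots> = q x / M - pmf p x"
      using p M by (simp add: field_simps)
    finally have "pmf p x * (ln (q x) - ln (pmf p x) - ln M) / ln 2 \<le> (q x / M - pmf p x) / ln 2"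
      by (intro divide_right_mono) auto
    then show ?thesis
      by (simp add: log_def diff_divide_distrib right_diff_distrib)
  qed
  have "(\<Sum>x\<in>?S. pmf p x * (log 2 (q x) - log 2 (pmf p x) - log 2 M))
      \<le> (\<Sum>x\<in>?S. (q x / M - pmf p x) / ln 2)"
    by (intro sum_mono summand)
  also have "\<dots> = ((\<Sum>x\<in>?S. q x) / M - 1) / ln 2"
    by (simp add: sum_divide_distrib[symmetric] sum_subtractf sum1)
  also have "\<dots> \<le> 0"
    using le M by (simp add: divide_le_0_iff)
  finally show ?thesis
    by (simp add: expectation_finite[OF fin] right_diff_distrib sum_subtractf
        sum_distrib_right[symmetric] sum1)
qed

section \<open>Lower bound on the leakage\<close>

text \<open>Moving from value pairs back to the underlying outcomes allows a pointwise comparison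
  with log-probabilities of the key.\<close>

lemma mutual_information_pmf_eq_expectation:
  fixes f :: "'a \<Rightarrow> 'b::countable" and g :: "'a \<Rightarrow> 'c::countable"
  assumes fin: "finite (set_pmf p)"
  shows "prob_space.mutual_information (measure_pmf p) 2 (count_space UNIV) (count_space UNIV) f g =
    measure_pmf.expectation p (\<lambda>w. log 2 (pmf (map_pmf (\<lambda>w. (f w, g w)) p) (f w, g w) /
      (pmf (map_pmf f p) (f w) * pmf (map_pmf g p) (g w))))"
proof -
  let ?J = "map_pmf (\<lambda>w. (f w, g w)) p"
  have "prob_space.mutual_information (measure_pmf p) 2 (count_space UNIV) (count_space UNIV) f g =
    measure_pmf.expectation ?J (\<lambda>(a, b). log 2 (pmf ?J (a, b) / (pmf (map_pmf f p) a * pmf (map_pmf g p) b)))"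
    using fin by (subst expectation_finite)
      (auto simp: mutual_information_pmf_eq_sum[OF fin] case_prod_beta)
  then show ?thesis by simp
qed

lemma pmf_le_pmf_map: "pmf p w \<le> pmf (map_pmf f p) (f w)"
  by (auto simp: pmf_map measure_pmf_single[symmetric] intro!: measure_pmf.finite_measure_mono)

lemma is_scheme_inj_on:
  assumes "is_scheme n \<Phi> \<Psi>" "k \<in> blocks n"
  shows "inj_on (\<Phi> k) (blocks n)"
  using assms unfolding is_scheme_def by (intro inj_on_inverseI[of _ "\<Psi> k"]) auto

lemma leakage_ge:
  fixes pX pK :: "'a::finite pmf"
  assumes scheme: "is_scheme n \<Phi> \<Psi>"
  shows "real n * (shannon_entropy pX - shannon_entropy pK) \<le> leakage n pX pK \<Phi>"
proof -
  define A where "A = replicate_pmf n pK"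
  define B where "B = replicate_pmf n pX"
  define P where "P = pair_pmf A B"
  define C where "C = map_pmf (\<lambda>(k, x). \<Phi> k x) P"
  define J where "J = map_pmf (\<lambda>w. ((\<lambda>(k, x). \<Phi> k x) w, (\<lambda>(k, x). x) w)) P"
  have finA: "finite (set_pmf A)" and finB: "finite (set_pmf B)"
    by (auto simp: A_def B_def finite_set_replicate_pmf)
  then have finP: "finite (set_pmf P)"
    by (simp add: P_def)
  have mB: "map_pmf (\<lambda>(k, x). x) P = B"
    using map_snd_pair_pmf[of A B] by (simp add: P_def case_prod_unfold)
  have C_pos: "pmf C (\<Phi> k x) > 0" if "k \<in> set_pmf A" "x \<in> set_pmf B" for k x
    using that by (force intro!: pmf_positive simp: C_def P_def)
  \<comment> \<open>Several keys may send x to the same ciphertext, so this is only an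
    inequality.\<close>
  have J_ge: "pmf A k * pmf B x \<le> pmf J (\<Phi> k x, x)" for k x
    using pmf_le_pmf_map[of P "(k, x)" "\<lambda>w. ((\<lambda>(k, x). \<Phi> k x) w, (\<lambda>(k, x). x) w)"]
    by (simp add: J_def P_def pmf_pair)
  \<comment> \<open>Gibbs is applied with the key fixed, since injectivity holds only for each
    \<open>\<Phi> k\<close> separately. The weight \<open>C\<close>, the ciphertext law over all
    keys, is the same for every k.\<close>
  have "measure_pmf.expectation A (\<lambda>k. measure_pmf.expectation B (\<lambda>x. log 2 (pmf C (\<Phi> k x))))
      \<le> measure_pmf.expectation A (\<lambda>_. measure_pmf.expectation B (\<lambda>x. log 2 (pmf B x)))"
  proof (rule expectation_mono_finite[OF finA])
    fix k assume k: "k \<in> set_pmf A"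
    have "inj_on (\<Phi> k) (set_pmf B)"
      using inj_on_subset[OF is_scheme_inj_on[OF scheme] set_replicate_pmf_subset_blocks] k
        set_replicate_pmf_subset_blocks[of n pK] unfolding A_def B_def by blast
    then have "(\<Sum>x\<in>set_pmf B. pmf C (\<Phi> k x)) = (\<Sum>c\<in>\<Phi> k ` set_pmf B. pmf C c)"
      by (simp add: sum.reindex)
    also have "\<dots> \<le> 1"
      using finB by (intro sum_pmf_le_1) auto
    finally show "measure_pmf.expectation B (\<lambda>x. log 2 (pmf C (\<Phi> k x)))
        \<le> measure_pmf.expectation B (\<lambda>x. log 2 (pmf B x))"
      using gibbs_inequality[of B "\<lambda>x. pmf C (\<Phi> k x)" 1] finB C_pos[OF k] by simp
  qed
  \<comment> \<open>The left-hand side is -H(C), so this reads H(C) \<ge> n H(X).\<close>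
  then have entropy_C: "measure_pmf.expectation P (\<lambda>(k, x). log 2 (pmf C (\<Phi> k x)))
      \<le> - real n * shannon_entropy pX"
    using expectation_log_pmf_replicate[of n pX, folded B_def]
    by (simp add: P_def expectation_pair_pmf_finite[OF finA finB])
  have entropy_K: "measure_pmf.expectation P (\<lambda>w. log 2 (pmf A (fst w)))
      = - real n * shannon_entropy pK"
    using expectation_log_pmf_replicate[of n pK, folded A_def]
    by (simp add: P_def expectation_pair_pmf_fst[where f = "\<lambda>k. log 2 (pmf A k)"])
  \<comment> \<open>The right-hand side is H(C) - n H(K); merged into one expectation, it is
    compared with the information density outcome by outcome.\<close>
  have "real n * (shannon_entropy pX - shannon_entropy pK)
      \<le> measure_pmf.expectation P (\<lambda>w. log 2 (pmf A (fst w)))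
        - measure_pmf.expectation P (\<lambda>(k, x). log 2 (pmf C (\<Phi> k x)))"
    using entropy_C entropy_K by (simp add: algebra_simps)
  also have "\<dots> = measure_pmf.expectation P
      (\<lambda>w. log 2 (pmf A (fst w)) - (case w of (k, x) \<Rightarrow> log 2 (pmf C (\<Phi> k x))))"
    by (simp add: Bochner_Integration.integral_diff integrable_measure_pmf_finite[OF finP])
  also have "\<dots> \<le> measure_pmf.expectation P (\<lambda>w. log 2 (pmf J ((\<lambda>(k, x). \<Phi> k x) w, (\<lambda>(k, x). x) w)
      / (pmf C ((\<lambda>(k, x). \<Phi> k x) w) * pmf B ((\<lambda>(k, x). x) w))))"
  proof (rule expectation_mono_finite[OF finP])
    fix w assume "w \<in> set_pmf P"
    then obtain k x where w: "w = (k, x)" and kx: "k \<in> set_pmf A" "x \<in> set_pmf B"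
      by (auto simp: P_def)
    have pos: "pmf A k > 0" "pmf B x > 0" "pmf C (\<Phi> k x) > 0"
      using kx C_pos by (auto intro: pmf_positive)
    have "log 2 (pmf A k) - log 2 (pmf C (\<Phi> k x)) = log 2 (pmf A k / pmf C (\<Phi> k x))"
      using pos by (simp add: log_divide)
    \<comment> \<open>The factor \<open>pmf B x\<close> is inserted so that \<open>J_ge\<close>
      applies to the numerator.\<close>
    also have "pmf A k / pmf C (\<Phi> k x) = (pmf A k * pmf B x) / (pmf C (\<Phi> k x) * pmf B x)"
      using pos by simp
    also have "log 2 \<dots> \<le> log 2 (pmf J (\<Phi> k x, x) / (pmf C (\<Phi> k x) * pmf B x))"
      using pos J_ge[of k x] by (intro log_mono divide_right_mono) auto
    finally show "log 2 (pmf A (fst w)) - (case w of (k, x) \<Rightarrow> log 2 (pmf C (\<Phi> k x)))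
        \<le> log 2 (pmf J ((\<lambda>(k, x). \<Phi> k x) w, (\<lambda>(k, x). x) w)
          / (pmf C ((\<lambda>(k, x). \<Phi> k x) w) * pmf B ((\<lambda>(k, x). x) w)))"
      by (simp add: w)
  qed
  also have "\<dots> = leakage n pX pK \<Phi>"
    unfolding leakage_def key_source_pmf_def A_def[symmetric] B_def[symmetric] P_def[symmetric]
      mutual_information_pmf_eq_expectation[OF finP] C_def[symmetric] J_def[symmetric] mB ..
  finally show ?thesis .
qed

section \<open>Lower bound on the average length\<close>

text \<open>A substitute for Kraft's inequality: the 2 ^ l words of length l together weigh r ^ l
  with r = 2 powr (- \<epsilon>), and the geometric series bounds the total. The bound is free of
  \<open>F\<close>, hence uniform in key and block length.\<close>

lemma sum_powr_length_le:
  fixes F :: "bool list set" and \<epsilon> :: real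
  assumes fin: "finite F" and \<epsilon>: "\<epsilon> > 0"
  shows "(\<Sum>c\<in>F. 2 powr (- (1 + \<epsilon>) * length c)) \<le> 1 / (1 - 2 powr (- \<epsilon>))"
proof -
  define r where "r = (2::real) powr (- \<epsilon>)"
  define T where "T = (\<lambda>l. {c :: bool list. length c = l})"
  have r: "0 < r" "r < 1"
    using \<epsilon> powr_less_mono[of "- \<epsilon>" 0 2] by (auto simp: r_def)
  have finT: "finite (T l)" and cardT: "card (T l) = 2 ^ l" for l
    using finite_lists_length_eq[of "UNIV :: bool set" l] card_lists_length_eq[of "UNIV :: bool set" l]
    by (auto simp: T_def)
  obtain N where N: "\<forall>l\<in>length ` F. l < N"
    using fin finite_nat_set_iff_bounded[of "length ` F"] by auto
  have "(\<Sum>c\<in>F. 2 powr (- (1 + \<epsilon>) * length c))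
      \<le> (\<Sum>c\<in>(\<Union>l\<in>{..<N}. T l). 2 powr (- (1 + \<epsilon>) * length c))"
    using N finT by (intro sum_mono2) (auto simp: T_def)
  also have "\<dots> = (\<Sum>l<N. \<Sum>c\<in>T l. 2 powr (- (1 + \<epsilon>) * length c))"
    using finT by (intro sum.UNION_disjoint) (auto simp: T_def)
  also have "\<dots> = (\<Sum>l<N. r ^ l)"
  proof (intro sum.cong refl)
    fix l
    have "(\<Sum>c\<in>T l. 2 powr (- (1 + \<epsilon>) * length c)) = (\<Sum>c\<in>T l. 2 powr (- (1 + \<epsilon>) * l))"
      by (intro sum.cong) (auto simp: T_def)
    also have "\<dots> = 2 powr l * 2 powr (- (1 + \<epsilon>) * l)"
      by (simp add: cardT powr_realpow)
    also have "\<dots> = r ^ l"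
      by (simp add: r_def powr_add[symmetric] powr_powr powr_realpow[symmetric] algebra_simps)
    finally show "(\<Sum>c\<in>T l. 2 powr (- (1 + \<epsilon>) * length c)) = r ^ l" .
  qed
  also have "\<dots> = (1 - r ^ N) / (1 - r)"
    using r by (simp add: sum_gp_strict)
  also have "\<dots> \<le> 1 / (1 - r)"
    using r by (intro divide_right_mono) auto
  finally show ?thesis
    by (simp add: r_def)
qed

lemma avg_length_ge:
  fixes pX pK :: "'a::finite pmf"
  assumes scheme: "is_scheme n \<Phi> \<Psi>" and \<epsilon>: "\<epsilon> > 0"
  shows "real n * shannon_entropy pX
    \<le> (1 + \<epsilon>) * avg_length n pX pK \<Phi> + log 2 (1 / (1 - 2 powr (- \<epsilon>)))"
proof -
  define A where "A = replicate_pmf n pK"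
  define B where "B = replicate_pmf n pX"
  define M where "M = 1 / (1 - 2 powr (- \<epsilon>))"
  have finA: "finite (set_pmf A)" and finB: "finite (set_pmf B)"
    by (auto simp: A_def B_def finite_set_replicate_pmf)
  \<comment> \<open>The left-hand side is constant in k: the bound is shown for each fixed key and
    then averaged.\<close>
  have "measure_pmf.expectation A (\<lambda>_. real n * shannon_entropy pX)
    \<le> measure_pmf.expectation A (\<lambda>k. (1 + \<epsilon>) *
        measure_pmf.expectation B (\<lambda>x. real (length (\<Phi> k x))) + log 2 M)"
  proof (rule expectation_mono_finite[OF finA])
    fix k assume k: "k \<in> set_pmf A"
    \<comment> \<open>The logarithm of this weight is linear in the length, so Gibbs turns into a
      bound on the expected length.\<close>
    let ?q = "\<lambda>c :: bool list. 2 powr (- (1 + \<epsilon>) * length c)"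
    have "inj_on (\<Phi> k) (set_pmf B)"
      using inj_on_subset[OF is_scheme_inj_on[OF scheme] set_replicate_pmf_subset_blocks] k
        set_replicate_pmf_subset_blocks[of n pK] unfolding A_def B_def by blast
    then have "(\<Sum>x\<in>set_pmf B. ?q (\<Phi> k x)) = (\<Sum>c\<in>\<Phi> k ` set_pmf B. ?q c)"
      by (simp add: sum.reindex)
    also have "\<dots> \<le> M"
      unfolding M_def using finB \<epsilon> by (intro sum_powr_length_le) auto
    finally have "measure_pmf.expectation B (\<lambda>x. log 2 (?q (\<Phi> k x)))
        \<le> measure_pmf.expectation B (\<lambda>x. log 2 (pmf B x)) + log 2 M"
      by (intro gibbs_inequality[OF finB]) auto
    moreover have "measure_pmf.expectation B (\<lambda>x. log 2 (?q (\<Phi> k x)))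
        = - (1 + \<epsilon>) * measure_pmf.expectation B (\<lambda>x. real (length (\<Phi> k x)))"
      by (simp add: log_powr del: minus_add_distrib)
    ultimately show "real n * shannon_entropy pX
        \<le> (1 + \<epsilon>) * measure_pmf.expectation B (\<lambda>x. real (length (\<Phi> k x))) + log 2 M"
      using expectation_log_pmf_replicate[of n pX] by (simp add: B_def algebra_simps)
  qed
  then show ?thesis
    by (simp add: Bochner_Integration.integral_add integrable_measure_pmf_finite[OF finA]
        avg_length_def key_source_pmf_def A_def[symmetric] B_def[symmetric] M_def[symmetric]
        expectation_pair_pmf_finite[OF finA finB])
qed

section \<open>Passage to the limit and conclusion\<close>

text \<open>This replaces dividing by n and letting n grow; it absorbs both \<open>\<delta>\<close>
  and the additive constant of the length bound.\<close>

lemma le_of_mult_le_const: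
  fixes a c :: real
  assumes "\<And>n. n \<ge> n0 \<Longrightarrow> real n * a \<le> c"
  shows "a \<le> 0"
proof (rule ccontr)
  assume "\<not> a \<le> 0"
  then obtain m where m: "c < real m * a"
    using reals_Archimedean3[of a] by auto
  \<comment> \<open>The maximum keeps the product above c while staying in the range of the
    hypothesis.\<close>
  also have "real m * a \<le> real (max m n0) * a"
    using \<open>\<not> a \<le> 0\<close> by (intro mult_right_mono) auto
  also have "\<dots> \<le> c"
    by (intro assms) simp
  finally show False by simp
qed

lemma admissible_imp_entropy_le_key:
  assumes "admissible \<delta> pX pK R"
  shows "shannon_entropy pX \<le> shannon_entropy pK"
proof -
  obtain \<Phi> \<Psi> where scheme: "\<forall>n\<ge>1. is_scheme n (\<Phi> n) (\<Psi> n)"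
    and rate: "\<forall>\<gamma>>0. \<exists>n0\<ge>1. \<forall>n\<ge>n0.
          avg_length n pX pK (\<Phi> n) / real n \<le> R + \<gamma> \<and> leakage n pX pK (\<Phi> n) \<le> \<delta>"
    using assms unfolding admissible_def by blast
  obtain n0 :: nat where "n0 \<ge> 1" and n0: "\<And>n. n \<ge> n0 \<Longrightarrow> leakage n pX pK (\<Phi> n) \<le> \<delta>"
    \<comment> \<open>Any positive slack would do, as only the leakage clause is extracted.\<close>
    using rate[rule_format, of 1] by auto
  have "real n * (shannon_entropy pX - shannon_entropy pK) \<le> \<delta>" if "n \<ge> n0" for n
    using leakage_ge[of n "\<Phi> n" "\<Psi> n" pX pK] scheme n0[OF that] that \<open>n0 \<ge> 1\<close> by fastforce
  then show ?thesis
    using le_of_mult_le_const by fastforce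
qed

lemma admissible_imp_entropy_le_rate:
  assumes "admissible \<delta> pX pK R"
  shows "shannon_entropy pX \<le> R"
proof -
  obtain \<Phi> \<Psi> where scheme: "\<forall>n\<ge>1. is_scheme n (\<Phi> n) (\<Psi> n)"
    and rate: "\<forall>\<gamma>>0. \<exists>n0\<ge>1. \<forall>n\<ge>n0.
          avg_length n pX pK (\<Phi> n) / real n \<le> R + \<gamma> \<and> leakage n pX pK (\<Phi> n) \<le> \<delta>"
    using assms unfolding admissible_def by blast
  \<comment> \<open>One \<epsilon> serves both as the excess exponent of the length weight and as
    the rate slack, so a single limit removes both.\<close>
  have bound: "shannon_entropy pX \<le> (1 + \<epsilon>) * (R + \<epsilon>)" if \<epsilon>: "\<epsilon> > 0" for \<epsilon> :: real
  proof -
    obtain n0 :: nat where "n0 \<ge> 1"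
      and n0: "\<And>n. n \<ge> n0 \<Longrightarrow> avg_length n pX pK (\<Phi> n) / real n \<le> R + \<epsilon>"
      using rate \<epsilon> by blast
    \<comment> \<open>The right-hand side depends on \<epsilon> but not on n.\<close>
    have "real n * (shannon_entropy pX - (1 + \<epsilon>) * (R + \<epsilon>)) \<le> log 2 (1 / (1 - 2 powr (- \<epsilon>)))"
      if n: "n \<ge> n0" for n
    proof -
      have "avg_length n pX pK (\<Phi> n) \<le> real n * (R + \<epsilon>)"
        using n0[OF n] n \<open>n0 \<ge> 1\<close> by (simp add: field_simps)
      then have "(1 + \<epsilon>) * avg_length n pX pK (\<Phi> n) \<le> (1 + \<epsilon>) * (real n * (R + \<epsilon>))"
        using \<epsilon> by (intro mult_left_mono) auto
      moreover have "real n * shannon_entropy pX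
          \<le> (1 + \<epsilon>) * avg_length n pX pK (\<Phi> n) + log 2 (1 / (1 - 2 powr (- \<epsilon>)))"
        using scheme n \<open>n0 \<ge> 1\<close> \<epsilon> by (intro avg_length_ge[of n "\<Phi> n" "\<Psi> n"]) auto
      ultimately show ?thesis
        by (simp add: algebra_simps)
    qed
    then show ?thesis
      using le_of_mult_le_const by fastforce
  qed
  have "((\<lambda>\<epsilon>. (1 + \<epsilon>) * (R + \<epsilon>)) \<longlongrightarrow> (1 + 0) * (R + 0)) (at_right 0)"
    by (intro tendsto_intros)
  moreover have "\<forall>\<^sub>F \<epsilon> in at_right 0. shannon_entropy pX \<le> (1 + \<epsilon>) * (R + \<epsilon>)"
    using bound by (auto simp: eventually_at_right_field intro: exI[of _ 1])
  ultimately have "shannon_entropy pX \<le> (1 + 0) * (R + 0)"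
    by (rule tendsto_lowerbound) simp
  then show ?thesis by simp
qed

theorem theorem2:
  fixes pX pK :: "'a::{finite,field} pmf" and \<delta>\<^sub>0 \<delta> :: real
  assumes "\<delta>\<^sub>0 > 0" and "\<delta> \<in> {0<..\<delta>\<^sub>0}"
  shows "R_star pX pK \<le> R_vinf_delta \<delta> pX pK \<and> R_vinf_delta \<delta> pX pK \<le> R_vinf \<delta>\<^sub>0 pX pK"
proof
  \<comment> \<open>If H(X) > H(K), no rate is admissible and the infimum over the empty set is
    infinite, matching the infinite branch of \<open>R_star\<close>.\<close>
  show "R_star pX pK \<le> R_vinf_delta \<delta> pX pK"
    unfolding R_vinf_delta_def R_star_def
    by (intro INF_greatest)
      (auto dest: admissible_imp_entropy_le_key admissible_imp_entropy_le_rate)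
  show "R_vinf_delta \<delta> pX pK \<le> R_vinf \<delta>\<^sub>0 pX pK"
    unfolding R_vinf_def by (rule SUP_upper) (rule assms(2))
qed

end
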